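(* For $\beta>0$ and $n\geq1$ let $F_{n,\beta}=f_\beta:\mathbb{R}^n\to\mathbb{R}$, $f_\beta(x)=\frac1\beta\log\big(\sum_{i=1}^ne^{\beta x_i}\big)$, and let $\gamma_n$ be the standard Gaussian measure on $\mathbb{R}^n$. Then the following hold. (1) (High temperature regime) For every $0<\beta<\sqrt{\frac{\ln 2}{2}}$ and every $n\geq1$, $$\mathrm{Var}_{\gamma_n}(F_{n,\beta})\leq\left(\frac{1-\beta^2}{1-2\beta^2}\right)\frac1n.$$ (2) (Low temperature regime) There exists a universal constant $C>0$ such that, for every sequence $(\beta_n)_{n\ge 1}$ of positive reals with $\beta_n\sim\sqrt{\log n}$ as $n\to\infty$ and every integer $n\geq e$, $$\mathrm{Var}_{\gamma_n}(F_{n,\beta_n})\leq\frac{C}{\log n}.$$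
   Context: $\mathrm{Var}_{\gamma_n}(f)=\int f^2d\gamma_n-(\int f\,d\gamma_n)^2$. Here $F_{n,\beta}$ is the free energy of the Random Energy Model in the normalization with $n$ i.i.d. standard Gaussian energies $x_1,\dots,x_n$, i.e. the function $f_\beta$ under $\gamma_n$. The notation $\beta_n\sim\sqrt{\log n}$ means $\beta_n/\sqrt{\log n}\to1$ as $n\to\infty$. *)

theory Defs
  imports "HOL-Probability.Probability"
begin

text \<open>A vector of \<open>\<real>\<^sup>n\<close> is a function on the index set \<open>{1..n}\<close> (with the default value
  outside it), as in the library's finite product measure, so that the dimension can be
  quantified over.\<close>

definition std_gaussian :: "nat \<Rightarrow> (nat \<Rightarrow> real) measure" where
  "std_gaussian n = (\<Pi>\<^sub>M i\<in>{1..n}. density lborel std_normal_density)"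

definition Var_gaussian :: "nat \<Rightarrow> ((nat \<Rightarrow> real) \<Rightarrow> real) \<Rightarrow> real" where
  "Var_gaussian n f =
     (\<integral>x. (f x)\<^sup>2 \<partial>std_gaussian n) - (\<integral>x. f x \<partial>std_gaussian n)\<^sup>2"

definition free_energy :: "nat \<Rightarrow> real \<Rightarrow> (nat \<Rightarrow> real) \<Rightarrow> real" where
  "free_energy n \<beta> x = 1 / \<beta> * ln (\<Sum>i=1..n. exp (\<beta> * x i))"

text \<open>The Bochner integral of a non-integrable function is \<open>0\<close>; the following facts show that
  both integrals in the variance of the free energy are genuine.\<close>

lemma prob_space_std_gaussian: "prob_space (std_gaussian n)"
  unfolding std_gaussian_def
  by (intro prob_space_PiM prob_space_normal_density) simp

lemma free_energy_measurable [measurable]: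
  "free_energy n \<beta> \<in> borel_measurable (std_gaussian n)"
proof -
  have "(\<lambda>x. x i) \<in> borel_measurable (std_gaussian n)" if "i \<in> {1..n}" for i
  proof -
    have "(\<lambda>x. x i) \<in> measurable (std_gaussian n) (density lborel (\<lambda>x. ennreal (std_normal_density x)))"
      unfolding std_gaussian_def using that by (rule measurable_component_singleton)
    then show ?thesis by (simp cong: measurable_cong_sets)
  qed
  then show ?thesis
    unfolding free_energy_def by measurable
qed

lemma integrable_coord_sq:
  assumes i: "i \<in> {1..n}"
  shows "integrable (std_gaussian n) (\<lambda>x. (x i)\<^sup>2)"
proof -
  let ?D = "density lborel (\<lambda>x. ennreal (std_normal_density x))"
  have d: "distr (std_gaussian n) ?D (\<lambda>x. x i) = ?D"
    unfolding std_gaussian_def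
    by (rule distr_PiM_component) (use i in \<open>auto intro: prob_space_normal_density\<close>)
  have m: "(\<lambda>x. x i) \<in> measurable (std_gaussian n) ?D"
    unfolding std_gaussian_def using i by (rule measurable_component_singleton)
  have "integrable ?D (\<lambda>x. x\<^sup>2)"
    by (subst integrable_real_density)
       (use integrable_std_normal_moment[of 2] in \<open>auto\<close>)
  then have "integrable (distr (std_gaussian n) ?D (\<lambda>x. x i)) (\<lambda>x. x\<^sup>2)"
    by (simp only: d)
  then show ?thesis
    by (subst (asm) integrable_distr_eq[OF m]) auto
qed

lemma abs_free_energy_le:
  assumes n: "n \<ge> 1" and b: "\<beta> > 0"
  shows "\<bar>free_energy n \<beta> x\<bar> \<le> ln (real n) / \<beta> + (\<Sum>i=1..n. \<bar>x i\<bar>)"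
proof -
  let ?S = "\<Sum>i=1..n. exp (\<beta> * x i)" and ?A = "\<Sum>i=1..n. \<bar>x i\<bar>"
  have le: "\<bar>x i\<bar> \<le> ?A" if "i \<in> {1..n}" for i
    using that by (intro member_le_sum) auto
  have pos: "?S > 0" using n by (intro sum_pos) auto
  have "?S \<le> (\<Sum>i=1..n. exp (\<beta> * ?A))"
  proof (rule sum_mono)
    fix i assume "i \<in> {1..n}"
    then have "x i \<le> ?A" using le[of i] by linarith
    then show "exp (\<beta> * x i) \<le> exp (\<beta> * ?A)" using b by simp
  qed
  also have "\<dots> = real n * exp (\<beta> * ?A)" by simp
  finally have "ln ?S \<le> ln (real n * exp (\<beta> * ?A))" using pos n by simp
  then have up: "ln ?S \<le> ln (real n) + \<beta> * ?A" using n by (simp add: ln_mult)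
  have "- ?A \<le> x 1" using le[of 1] n by simp
  then have "exp (\<beta> * - ?A) \<le> exp (\<beta> * x 1)" using b by (metis exp_le_cancel_iff mult_le_cancel_left_pos)
  also have "\<dots> \<le> ?S" using n by (intro member_le_sum) auto
  finally have lo: "- (\<beta> * ?A) \<le> ln ?S" using pos by (simp add: ln_ge_iff)
  have "0 \<le> ln (real n)" using n by simp
  then have "\<bar>ln ?S\<bar> \<le> ln (real n) + \<beta> * ?A" using up lo by linarith
  then show ?thesis
    unfolding free_energy_def using b by (simp add: abs_mult field_simps)
qed

lemma free_energy_integrable:
  assumes n: "n \<ge> 1" and b: "\<beta> > 0"
  shows "integrable (std_gaussian n) (\<lambda>x. (free_energy n \<beta> x)\<^sup>2)"
    and "integrable (std_gaussian n) (free_energy n \<beta>)"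
proof -
  interpret prob_space "std_gaussian n" by (rule prob_space_std_gaussian)
  let ?c = "ln (real n) / \<beta>"
  let ?g = "\<lambda>x. 2 * ?c\<^sup>2 + 2 * (real n * (\<Sum>i=1..n. (x i)\<^sup>2))"
  have g: "integrable (std_gaussian n) ?g"
    by (intro Bochner_Integration.integrable_add integrable_const
          integrable_mult_right Bochner_Integration.integrable_sum integrable_coord_sq)
  have bd: "(free_energy n \<beta> x)\<^sup>2 \<le> ?g x" for x
  proof -
    let ?A = "\<Sum>i=1..n. \<bar>x i\<bar>"
    have "(free_energy n \<beta> x)\<^sup>2 \<le> (?c + ?A)\<^sup>2"
      using abs_free_energy_le[OF n b, of x] by (metis abs_ge_zero power2_abs power_mono)
    also have "\<dots> \<le> 2 * ?c\<^sup>2 + 2 * ?A\<^sup>2"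
      using zero_le_power2[of "?c - ?A"] unfolding power2_diff power2_sum by linarith
    also have "?A\<^sup>2 \<le> real n * (\<Sum>i=1..n. (x i)\<^sup>2)"
      using sum_squared_le_sum_of_squares[of "\<lambda>i. \<bar>x i\<bar>" "{1..n}"] by (simp add: mult.commute)
    finally show ?thesis by simp
  qed
  show sq: "integrable (std_gaussian n) (\<lambda>x. (free_energy n \<beta> x)\<^sup>2)"
  proof (rule Bochner_Integration.integrable_bound[OF g])
    show "(\<lambda>x. (free_energy n \<beta> x)\<^sup>2) \<in> borel_measurable (std_gaussian n)" by measurable
    show "AE x in std_gaussian n. norm ((free_energy n \<beta> x)\<^sup>2) \<le> norm (?g x)"
    proof (rule AE_I2)
      fix x show "norm ((free_energy n \<beta> x)\<^sup>2) \<le> norm (?g x)"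
        using bd[of x] by (smt (verit) real_norm_def zero_le_power2)
    qed
  qed
  show "integrable (std_gaussian n) (free_energy n \<beta>)"
    by (rule square_integrable_imp_integrable[OF free_energy_measurable sq])
qed

end

theory Submission
  imports Defs
begin

text \<open>Let \<open>0 \<le> a < 1/2\<close>. The odd function \<open>u s = s * exp (a * s\<^sup>2)\<close> is an exact ground state of a
  weighted Gaussian Sturm--Liouville problem, which gives for a smooth \<open>g\<close> in one variable
  \<open>E (g - g 0)\<^sup>2 \<le> E (g'\<^sup>2 / ((1 - 2a) (1 + 2a s\<^sup>2)))\<close>. Its left-hand side dominates the variance, and
  the inequality tensorizes; \<open>a = 0\<close> is the Poincare inequality with its sharp constant.

  The partial derivatives of the free energy are the Gibbs weights \<open>\<nu>\<^sub>i\<close>, whose expectations are \<open>1/n\<close>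
  by exchangeability. Let \<open>S = E (\<Sum>i. \<nu>\<^sub>i\<^sup>2)\<close>. At high temperature the case \<open>a = 0\<close> is used twice:
  applied to the free energy it bounds the variance by \<open>S\<close>, and applied to each \<open>\<nu>\<^sub>i\<close>, whose gradients
  together have squared norm at most \<open>\<beta>\<^sup>2 * (\<Sum>i. \<nu>\<^sub>i\<^sup>2)\<close>, it gives \<open>S \<le> 1/n + \<beta>\<^sup>2 * S\<close>. Hence the variance is
  at most \<open>1 / ((1 - \<beta>\<^sup>2) n)\<close>, and \<open>1 - 2\<beta>\<^sup>2 \<le> (1 - \<beta>\<^sup>2)\<^sup>2\<close>.

  At low temperature \<open>a = 1/4\<close> bounds the variance by \<open>E (\<Sum>i. 4 \<nu>\<^sub>i\<^sup>2 / (2 + x\<^sub>i\<^sup>2))\<close>. Coordinates above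
  a level \<open>t\<close> contribute at most \<open>4 / t\<^sup>2\<close>; a coordinate below \<open>t\<close> has weight at most \<open>1 / (1 + N)\<close>, where
  \<open>N\<close> counts the coordinates above \<open>t\<close>. For \<open>t\<^sup>2 = ln n / 2\<close> \<open>E (1 / (1 + N))\<close> is at most of order
  \<open>1 / sqrt n\<close>, so the first contribution dominates.\<close>

section \<open>A weighted Hardy inequality for the one-dimensional Gaussian\<close>

lemma integrable_std_normal_power: "integrable std_normal_distribution (\<lambda>t. t ^ k)"
  by (subst integrable_real_density) (use integrable_std_normal_moment[of k] in auto)

lemma std_normal_density_has_derivative:
  "(std_normal_density has_real_derivative - x * std_normal_density x) (at x)"
  unfolding std_normal_density_def
  by (auto intro!: derivative_eq_intros simp: field_simps power2_eq_square)

text \<open>With \<open>c = 1 - 2 * a\<close>, \<open>D s = 1 + 2 * a * s\<^sup>2\<close>, \<open>w = 1 / (c * D)\<close>, \<open>\<phi>\<close> the Gaussian density and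
  \<open>u s = s * exp (a * s\<^sup>2)\<close>, one has \<open>(w * \<phi> * u')' = - \<phi> * u\<close>. The differentiated function is
  \<open>h\<^sup>2 * w * \<phi> * u' / u\<close>, and \<open>u' / u = D s / s\<close> appears in the square.\<close>

lemma hardy_boundary_derivative:
  fixes h h' :: "real \<Rightarrow> real" and a s :: real
  assumes a: "0 \<le> a" "a < 1/2" and s: "s \<noteq> 0"
    and h: "(h has_real_derivative h' s) (at s)"
  shows "((\<lambda>t. (h t)\<^sup>2 * std_normal_density t / ((1 - 2 * a) * t)) has_real_derivative
     std_normal_density s * ((h' s)\<^sup>2 / ((1 - 2 * a) * (1 + 2 * a * s\<^sup>2)) - (h s)\<^sup>2
       - (h' s - h s * (1 + 2 * a * s\<^sup>2) / s)\<^sup>2 / ((1 - 2 * a) * (1 + 2 * a * s\<^sup>2)))) (at s)"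
proof -
  define c D p where "c = 1 - 2 * a" and "D = 1 + 2 * a * s\<^sup>2" and "p = std_normal_density s"
  have c: "c > 0" and D: "D > 0" using a by (auto simp: c_def D_def intro!: add_pos_nonneg)
  have "((\<lambda>t. (h t)\<^sup>2 * std_normal_density t / ((1 - 2 * a) * t)) has_real_derivative
     ((2 * h s * h' s * p + (h s)\<^sup>2 * (- s * p)) * (c * s) - (h s)\<^sup>2 * p * c) / (c * s)\<^sup>2) (at s)"
    unfolding c_def p_def using s a
    by (auto intro!: derivative_eq_intros h std_normal_density_has_derivative
        simp: power2_eq_square algebra_simps)
  also have "((2 * h s * h' s * p + (h s)\<^sup>2 * (- s * p)) * (c * s) - (h s)\<^sup>2 * p * c) / (c * s)\<^sup>2
     = p * (2 * h s * h' s / (c * s) - (h s)\<^sup>2 / c - (h s)\<^sup>2 / (c * s\<^sup>2))"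
    using c s by (simp add: field_simps power2_eq_square)
  also have "2 * h s * h' s / (c * s) - (h s)\<^sup>2 / c - (h s)\<^sup>2 / (c * s\<^sup>2) =
     2 * h s * h' s / (c * s) - (h s)\<^sup>2 - (h s)\<^sup>2 * D / (c * s\<^sup>2)"
  \<comment> \<open>The identity \<open>s\<^sup>2 + 1 = c * s\<^sup>2 + D\<close> is what remains of
    the ground state equation after dividing by \<open>u\<close>: it splits off exactly
    \<open>(h s)\<^sup>2\<close> with coefficient one.\<close>
  proof -
    have "(h s)\<^sup>2 / c + (h s)\<^sup>2 / (c * s\<^sup>2) = (h s)\<^sup>2 * ((s\<^sup>2 + 1) / (c * s\<^sup>2))"
      using c s by (simp add: field_simps)
    also have "s\<^sup>2 + 1 = c * s\<^sup>2 + D" by (simp add: c_def D_def algebra_simps)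
    also have "(h s)\<^sup>2 * ((c * s\<^sup>2 + D) / (c * s\<^sup>2)) = (h s)\<^sup>2 + (h s)\<^sup>2 * D / (c * s\<^sup>2)"
      using c s by (simp add: field_simps)
    finally show ?thesis by linarith
  qed
  \<comment> \<open>Completing the square: the cross term and the term in
    \<open>D / (c * s\<^sup>2)\<close> are two of the three terms of
    \<open>(h' s - h s * D / s)\<^sup>2 / (c * D)\<close>.\<close>
  also have "\<dots> = (h' s)\<^sup>2 / (c * D) - (h s)\<^sup>2 - (h' s - h s * D / s)\<^sup>2 / (c * D)"
    using c D s by (simp add: field_simps power2_eq_square)
  finally show ?thesis by (simp add: c_def D_def p_def)
qed

text \<open>Since \<open>h 0 = 0\<close>, the factor \<open>h t / t\<close> tends to
  \<open>d\<close> while the second factor \<open>h t\<close> tends to 0. The limit 0 agrees with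
  the value at 0, where the numerator vanishes.\<close>

lemma hardy_boundary_isCont_0:
  fixes h :: "real \<Rightarrow> real"
  assumes h: "(h has_real_derivative d) (at 0)" and h0: "h 0 = 0"
  shows "isCont (\<lambda>t. (h t)\<^sup>2 * std_normal_density t / (c * t)) 0"
proof -
  have "((\<lambda>t. h t / t) \<longlongrightarrow> d) (at 0)"
    using h h0 by (simp add: has_field_derivative_iff)
  moreover have "(h \<longlongrightarrow> 0) (at 0)"
    using DERIV_isCont[OF h] h0 by (simp add: isCont_def)
  moreover have "(std_normal_density \<longlongrightarrow> std_normal_density 0) (at 0)"
    using DERIV_isCont[OF std_normal_density_has_derivative[of 0]] by (simp add: isCont_def)
  ultimately have "((\<lambda>t. h t / t * h t * std_normal_density t / c)
      \<longlongrightarrow> d * 0 * std_normal_density 0 / c) (at 0)"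
    unfolding divide_inverse[of _ c] by (intro tendsto_intros)
  then show ?thesis
    by (simp add: isCont_def power2_eq_square h0 mult_ac)
qed

text \<open>Integrating the derivative identity turns the difference of the two sides into an
  integrated square plus boundary terms. The boundary function has the sign of its argument, so both
  terms can be discarded.\<close>

lemma hardy_interval:
  fixes h h' :: "real \<Rightarrow> real" and a R :: real
  assumes a: "0 \<le> a" "a < 1/2" and R: "0 \<le> R"
    and h: "\<And>s. (h has_real_derivative h' s) (at s)" and h0: "h 0 = 0"
    and h': "continuous_on UNIV h'"
  shows "integral {-R..R} (\<lambda>s. std_normal_density s * (h s)\<^sup>2)
     \<le> integral {-R..R} (\<lambda>s. std_normal_density s * ((h' s)\<^sup>2 / ((1 - 2 * a) * (1 + 2 * a * s\<^sup>2))))"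
    (is "integral _ ?f \<le> integral _ ?g")
proof -
  let ?B = "\<lambda>t. (h t)\<^sup>2 * std_normal_density t / ((1 - 2 * a) * t)"
  let ?B' = "\<lambda>s. std_normal_density s * ((h' s)\<^sup>2 / ((1 - 2 * a) * (1 + 2 * a * s\<^sup>2)) - (h s)\<^sup>2
       - (h' s - h s * (1 + 2 * a * s\<^sup>2) / s)\<^sup>2 / ((1 - 2 * a) * (1 + 2 * a * s\<^sup>2)))"
  have D: "1 + 2 * a * s\<^sup>2 > 0" for s :: real using a by (intro add_pos_nonneg) auto
  have cn: "continuous_on UNIV std_normal_density"
    by (rule DERIV_continuous_on) (rule DERIV_subset[OF std_normal_density_has_derivative], simp)
  have ch: "continuous_on UNIV h"
    by (rule DERIV_continuous_on) (rule DERIV_subset[OF h], simp)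
  have f: "?f integrable_on {-R..R}"
    by (intro integrable_continuous_interval continuous_intros
        continuous_on_subset[OF cn] continuous_on_subset[OF ch]) auto
  have g: "?g integrable_on {-R..R}"
    by (intro integrable_continuous_interval continuous_intros
        continuous_on_subset[OF cn] continuous_on_subset[OF h'])
       (use a D in \<open>auto simp: less_imp_neq[THEN not_sym]\<close>)
  \<comment> \<open>The formula for the derivative divides by \<open>s\<close>, so 0 is made an
    exceptional point; there continuity suffices.\<close>
  have B': "(?B' has_integral (?B R - ?B (-R))) {-R..R}"
  proof (rule fundamental_theorem_of_calculus_strong[where S="{0}"])
    show "continuous_on {-R..R} ?B"
    proof (rule continuous_at_imp_continuous_on, rule ballI)
      fix s show "isCont ?B s"
      proof (cases "s = 0")
        case True
        then show ?thesis using hardy_boundary_isCont_0[OF h h0] by blast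
      next
        case False
        show ?thesis by (rule DERIV_isCont[OF hardy_boundary_derivative[where h=h and h'=h', OF a False h]])
      qed
    qed
    show "(?B has_vector_derivative ?B' s) (at s)" if "s \<in> {-R..R} - {0}" for s
      using hardy_boundary_derivative[where h=h and h'=h', OF a _ h] that
      by (simp add: has_real_derivative_iff_has_vector_derivative[symmetric])
  qed (use R in auto)
  have "?B R \<ge> 0" "?B (-R) \<le> 0"
    using a R by (auto intro!: divide_nonneg_nonneg mult_nonneg_nonneg)
  then have "integral {-R..R} ?f \<le> integral {-R..R} ?f + (?B R - ?B (-R))" by linarith
  also have "\<dots> = integral {-R..R} (\<lambda>s. ?f s + ?B' s)"
    using integral_unique[OF has_integral_add[OF integrable_integral[OF f] B']] by simp
  also have "\<dots> \<le> integral {-R..R} ?g"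
  proof (rule integral_le[OF _ g])
    show "(\<lambda>s. ?f s + ?B' s) integrable_on {-R..R}"
      using f B' by (intro integrable_add) auto
    \<comment> \<open>The discarded square is nonnegative at every \<open>s\<close>, including 0,
      where the quotient by \<open>s\<close> takes its default value.\<close>
    fix s
    have "0 \<le> std_normal_density s * ((h' s - h s * (1 + 2 * a * s\<^sup>2) / s)\<^sup>2 / ((1 - 2 * a) * (1 + 2 * a * s\<^sup>2)))"
      using a D[of s] by (intro mult_nonneg_nonneg divide_nonneg_nonneg) auto
    then show "?f s + ?B' s \<le> ?g s" by (simp add: algebra_simps)
  qed
  finally show ?thesis .
qed

text \<open>Passes from gauge integrals over bounded intervals, to which the fundamental theorem of
  calculus applies, to the Lebesgue integral on the line. The dominating function is the absolute
  value of \<open>f\<close>.\<close>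

lemma integral_symmetric_intervals_LIMSEQ:
  fixes f :: "real \<Rightarrow> real"
  assumes f: "integrable lborel f"
  shows "(\<lambda>k. integral {- real k..real k} f) \<longlonglongrightarrow> integral\<^sup>L lborel f"
proof -
  have "(\<lambda>k. \<integral>x. indicator {- real k..real k} x *\<^sub>R f x \<partial>lborel) \<longlonglongrightarrow> integral\<^sup>L lborel f"
  proof (rule integral_dominated_convergence[where w="\<lambda>x. \<bar>f x\<bar>"])
    show "AE x in lborel. (\<lambda>k. indicator {- real k..real k} x *\<^sub>R f x) \<longlonglongrightarrow> f x"
    proof (rule AE_I2, rule tendsto_eventually)
      fix x :: real
      show "\<forall>\<^sub>F k in sequentially. indicator {- real k..real k} x *\<^sub>R f x = f x"
        using eventually_ge_at_top[of "nat \<lceil>\<bar>x\<bar>\<rceil>"]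
        by eventually_elim (auto simp: indicator_def abs_le_iff; linarith)
    qed
  qed (use f in \<open>auto simp: indicator_def\<close>)
  moreover have "(\<integral>x. indicator {- real k..real k} x *\<^sub>R f x \<partial>lborel) = integral {- real k..real k} f" for k
  proof -
    have "set_integrable lborel {- real k..real k} f"
      unfolding set_integrable_def by (rule integrable_mult_indicator) (use f in auto)
    from set_borel_integral_eq_integral(2)[OF this] show ?thesis
      by (simp add: set_lebesgue_integral_def)
  qed
  ultimately show ?thesis by simp
qed

lemma weight_bounds:
  fixes a b M t :: real
  assumes a: "0 \<le> a" "a < 1/2" and b: "\<bar>b\<bar> \<le> M"
  shows "0 \<le> b\<^sup>2 / ((1 - 2 * a) * (1 + 2 * a * t\<^sup>2))"
    and "b\<^sup>2 / ((1 - 2 * a) * (1 + 2 * a * t\<^sup>2)) \<le> M\<^sup>2 / (1 - 2 * a)"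
proof -
  have D: "1 \<le> 1 + 2 * a * t\<^sup>2" using a by simp
  show "0 \<le> b\<^sup>2 / ((1 - 2 * a) * (1 + 2 * a * t\<^sup>2))"
    using a D by (intro divide_nonneg_nonneg mult_nonneg_nonneg) auto
  have "b\<^sup>2 \<le> M\<^sup>2" using power_mono[OF b, of 2] by simp
  moreover have "1 - 2 * a \<le> (1 - 2 * a) * (1 + 2 * a * t\<^sup>2)"
    using mult_left_mono[OF D, of "1 - 2 * a"] a by simp
  ultimately show "b\<^sup>2 / ((1 - 2 * a) * (1 + 2 * a * t\<^sup>2)) \<le> M\<^sup>2 / (1 - 2 * a)"
    using a by (intro frac_le) auto
qed

text \<open>This is the interval inequality for \<open>h = g - g 0\<close> in the limit of growing
  intervals. The bound on \<open>g'\<close> makes \<open>g\<close> grow at most linearly, so both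
  integrals converge. The reference value is \<open>g 0\<close> rather than the mean because the
  ground state is odd and vanishes at 0.\<close>

theorem gaussian_hardy:
  fixes g g' :: "real \<Rightarrow> real" and a M :: real
  assumes a: "0 \<le> a" "a < 1/2"
    and g: "\<And>s. (g has_real_derivative g' s) (at s)"
    and g': "continuous_on UNIV g'" and bd: "\<And>s. \<bar>g' s\<bar> \<le> M"
  shows "(\<integral>s. (g s - g 0)\<^sup>2 \<partial>std_normal_distribution) \<le> (\<integral>s. (g' s)\<^sup>2 / ((1 - 2 * a) * (1 + 2 * a * s\<^sup>2)) \<partial>std_normal_distribution)"
proof -
  let ?f = "\<lambda>s. (g s - g 0)\<^sup>2" and ?w = "\<lambda>s. (g' s)\<^sup>2 / ((1 - 2 * a) * (1 + 2 * a * s\<^sup>2))"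
  have [measurable]: "g \<in> borel_measurable borel" "g' \<in> borel_measurable borel"
    by (auto intro!: borel_measurable_continuous_onI g' DERIV_continuous_on[where D=g'] g DERIV_subset[OF g])
  have lip: "\<bar>g s - g 0\<bar> \<le> M * \<bar>s\<bar>" for s
    using field_differentiable_bound[where S=UNIV and f=g and f'=g' and B=M and x=s and y=0] g bd
    by simp
  interpret prob_space std_normal_distribution by (rule prob_space_normal_density) simp
  have fi: "integrable std_normal_distribution ?f"
  proof (rule Bochner_Integration.integrable_bound)
    show "integrable std_normal_distribution (\<lambda>s. M\<^sup>2 * s\<^sup>2)"
      by (intro integrable_mult_right integrable_std_normal_power)
    show "AE s in std_normal_distribution. norm (?f s) \<le> norm (M\<^sup>2 * s\<^sup>2)"
      proof (rule AE_I2)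
      show "norm (?f s) \<le> norm (M\<^sup>2 * s\<^sup>2)" for s
        using power_mono[OF lip[of s], of 2] by (simp add: power_mult_distrib)
    qed
  qed simp
  have wi: "integrable std_normal_distribution ?w"
  proof (rule integrable_const_bound[where B="M\<^sup>2 / (1 - 2 * a)"])
    show "AE s in std_normal_distribution. norm (?w s) \<le> M\<^sup>2 / (1 - 2 * a)"
      using weight_bounds[OF a bd] by (intro AE_I2) (simp only: real_norm_def abs_of_nonneg)
  qed simp
  have fi': "integrable lborel (\<lambda>s. std_normal_density s * ?f s)"
    and wi': "integrable lborel (\<lambda>s. std_normal_density s * ?w s)"
    using fi wi by (auto simp: integrable_real_density)
  have "integral\<^sup>L lborel (\<lambda>s. std_normal_density s * ?f s) \<le> integral\<^sup>L lborel (\<lambda>s. std_normal_density s * ?w s)"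
  proof (rule LIMSEQ_le[OF integral_symmetric_intervals_LIMSEQ[OF fi'] integral_symmetric_intervals_LIMSEQ[OF wi']])
    show "\<exists>N. \<forall>k\<ge>N. integral {- real k..real k} (\<lambda>s. std_normal_density s * ?f s)
       \<le> integral {- real k..real k} (\<lambda>s. std_normal_density s * ?w s)"
      by (intro exI allI impI hardy_interval a g')
         (auto intro!: derivative_eq_intros g)
  qed
  then show ?thesis by (simp add: integral_density)
qed

section \<open>Product Gaussian measures: integrability and Fubini\<close>

interpretation std_normal: prob_space std_normal_distribution
  by (rule prob_space_normal_density) simp

abbreviation normal_vector :: "nat set \<Rightarrow> (nat \<Rightarrow> real) measure" where
  "normal_vector I \<equiv> \<Pi>\<^sub>M i\<in>I. std_normal_distribution"

lemma prob_space_normal_vector: "prob_space (normal_vector I)"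
  by (intro prob_space_PiM std_normal.prob_space_axioms)

lemma measurable_coord [measurable]:
  "i \<in> I \<Longrightarrow> (\<lambda>x. x i) \<in> borel_measurable (normal_vector I)"
  using measurable_component_singleton[of i I "\<lambda>_. std_normal_distribution"] by (simp cong: measurable_cong_sets)

lemma integrable_coord:
  fixes f :: "real \<Rightarrow> real"
  assumes "i \<in> I" and f: "integrable std_normal_distribution f"
  shows "integrable (normal_vector I) (\<lambda>x. f (x i))"
proof -
  have D: "distr (normal_vector I) std_normal_distribution (\<lambda>x. x i) = std_normal_distribution"
    by (rule distr_PiM_component) (use assms in \<open>auto intro: std_normal.prob_space_axioms\<close>)
  have M: "(\<lambda>x. x i) \<in> measurable (normal_vector I) std_normal_distribution"
    using assms(1) by (rule measurable_component_singleton)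
  show ?thesis
    using integrable_distr[OF M, of f] f by (simp only: D)
qed

text \<open>By Cauchy-Schwarz the squared linear bound is at most a constant plus a multiple of the
  sum of squared coordinates, and Gaussian second moments are finite.\<close>

lemma integrable_power2_growth:
  fixes f :: "(nat \<Rightarrow> real) \<Rightarrow> real"
  assumes I: "finite I" and f [measurable]: "f \<in> borel_measurable (normal_vector I)"
    and growth: "\<And>x. \<bar>f x\<bar> \<le> c + d * (\<Sum>i\<in>I. \<bar>x i\<bar>)"
  shows "integrable (normal_vector I) (\<lambda>x. (f x)\<^sup>2)" "integrable (normal_vector I) f"
proof -
  interpret prob_space "normal_vector I" by (rule prob_space_normal_vector)
  let ?g = "\<lambda>x :: nat \<Rightarrow> real. 2 * c\<^sup>2 + 2 * (d\<^sup>2 * ((\<Sum>i\<in>I. (x i)\<^sup>2) * card I))"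
  have "integrable (normal_vector I) (\<lambda>x. (x i)\<^sup>2)" if "i \<in> I" for i
    using that integrable_std_normal_power[of 2] by (rule integrable_coord)
  then have g: "integrable (normal_vector I) ?g"
    by (intro Bochner_Integration.integrable_add integrable_const integrable_mult_left
          integrable_mult_right Bochner_Integration.integrable_sum)
  have bd: "(f x)\<^sup>2 \<le> ?g x" for x
  proof -
    have "(f x)\<^sup>2 \<le> (c + d * (\<Sum>i\<in>I. \<bar>x i\<bar>))\<^sup>2"
      using power_mono[OF growth[of x] abs_ge_zero, of 2] by simp
    also have "\<dots> \<le> 2 * c\<^sup>2 + 2 * (d * (\<Sum>i\<in>I. \<bar>x i\<bar>))\<^sup>2"
      using zero_le_power2[of "c - d * (\<Sum>i\<in>I. \<bar>x i\<bar>)"] unfolding power2_diff power2_sum by linarith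
    also have "(d * (\<Sum>i\<in>I. \<bar>x i\<bar>))\<^sup>2 \<le> d\<^sup>2 * ((\<Sum>i\<in>I. (x i)\<^sup>2) * card I)"
      using sum_squared_le_sum_of_squares[of "\<lambda>i. \<bar>x i\<bar>" I]
      by (simp add: power_mult_distrib mult_left_mono)
    finally show ?thesis by (simp add: power_mult_distrib)
  qed
  show 2: "integrable (normal_vector I) (\<lambda>x. (f x)\<^sup>2)"
  proof (rule Bochner_Integration.integrable_bound[OF g])
    show "AE x in normal_vector I. norm ((f x)\<^sup>2) \<le> norm (?g x)"
      using bd by (intro AE_I2) (smt (verit) real_norm_def zero_le_power2)
  qed simp
  show "integrable (normal_vector I) f"
    by (rule square_integrable_imp_integrable[OF f 2])
qed

lemma measurable_fun_upd_normal_vector: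
  assumes "f \<in> borel_measurable (normal_vector (insert j I))"
  shows "(\<lambda>y. f (y(j := t))) \<in> borel_measurable (normal_vector I)"
proof -
  have "(\<lambda>y. y(j := t)) \<in> measurable (normal_vector I) (normal_vector (insert j I))"
    by (rule measurable_fun_upd[where J=I]) auto
  from measurable_compose[OF this assms] show ?thesis .
qed

text \<open>Fubini for one coordinate against the others. Both orders occur below: the variance in
  the other coordinates is taken with \<open>t\<close> fixed, and the one-dimensional inequality is
  applied in \<open>t\<close> with \<open>y\<close> fixed.\<close>

lemma normal_vector_insert:
  fixes f :: "(nat \<Rightarrow> real) \<Rightarrow> real"
  assumes f: "integrable (normal_vector (insert j I)) f"
  shows "integrable std_normal_distribution (\<lambda>t. \<integral>y. f (y(j := t)) \<partial>normal_vector I)"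
    and "(\<integral>t. (\<integral>y. f (y(j := t)) \<partial>normal_vector I) \<partial>std_normal_distribution) = integral\<^sup>L (normal_vector (insert j I)) f"
    and "integrable (normal_vector I) (\<lambda>y. \<integral>t. f (y(j := t)) \<partial>std_normal_distribution)"
    and "(\<integral>y. (\<integral>t. f (y(j := t)) \<partial>std_normal_distribution) \<partial>normal_vector I) = integral\<^sup>L (normal_vector (insert j I)) f"
proof -
  interpret P: prob_space "normal_vector I" by (rule prob_space_normal_vector)
  interpret pair_sigma_finite std_normal_distribution "normal_vector I"
    by unfold_locales
  let ?Q = "std_normal_distribution \<Otimes>\<^sub>M normal_vector I"
  let ?u = "\<lambda>(t, y). y(j := t)"
  have u: "?u \<in> measurable ?Q (normal_vector (insert j I))"
    unfolding case_prod_beta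
    by (rule measurable_fun_upd[where J=I]) auto
  have d: "distr ?Q (normal_vector (insert j I)) ?u = normal_vector (insert j I)"
    by (rule distr_pair_PiM_eq_PiM) (rule std_normal.prob_space_axioms)+
  have c: "(\<lambda>z. f (?u z)) = (\<lambda>(t, y). f (y(j := t)))" by auto
  have fq: "integrable ?Q (\<lambda>(t, y). f (y(j := t)))"
    using integrable_distr[OF u, of f] f unfolding d c .
  have eq: "integral\<^sup>L ?Q (\<lambda>(t, y). f (y(j := t))) = integral\<^sup>L (normal_vector (insert j I)) f"
    using integral_distr[OF u borel_measurable_integrable[OF f]] unfolding d c by (rule sym)
  show "integrable std_normal_distribution (\<lambda>t. \<integral>y. f (y(j := t)) \<partial>normal_vector I)"
    using integrable_fst[OF fq] by simp
  show "integrable (normal_vector I) (\<lambda>y. \<integral>t. f (y(j := t)) \<partial>std_normal_distribution)"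
    using integrable_snd[OF fq] by simp
  show "(\<integral>t. (\<integral>y. f (y(j := t)) \<partial>normal_vector I) \<partial>std_normal_distribution) = integral\<^sup>L (normal_vector (insert j I)) f"
    using integral_fst[OF fq] eq by simp
  show "(\<integral>y. (\<integral>t. f (y(j := t)) \<partial>std_normal_distribution) \<partial>normal_vector I) = integral\<^sup>L (normal_vector (insert j I)) f"
    using integral_snd[OF fq] eq by simp
qed

section \<open>Tensorization of the one-dimensional inequality\<close>

lemma (in prob_space) variance_le_second_moment_about:
  fixes X :: "'a \<Rightarrow> real"
  assumes "integrable M X" "integrable M (\<lambda>x. (X x)\<^sup>2)"
  shows "expectation (\<lambda>x. (X x)\<^sup>2) - (expectation X)\<^sup>2 \<le> expectation (\<lambda>x. (X x - c)\<^sup>2)"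
proof -
  have "expectation (\<lambda>x. (X x - c)\<^sup>2) = expectation (\<lambda>x. (X x)\<^sup>2) - 2 * c * expectation X + c\<^sup>2"
    using assms by (simp add: power2_diff prob_space mult_ac)
  moreover have "(expectation X - c)\<^sup>2 \<ge> 0" by simp
  ultimately show ?thesis by (simp add: power2_diff algebra_simps)
qed

lemma (in prob_space) expectation_power2_le:
  fixes X :: "'a \<Rightarrow> real"
  assumes "integrable M X" "integrable M (\<lambda>x. (X x)\<^sup>2)"
  shows "(expectation X)\<^sup>2 \<le> expectation (\<lambda>x. (X x)\<^sup>2)"
proof -
  have "variance X \<ge> 0" by simp
  then show ?thesis using variance_eq[OF assms] by simp
qed

text \<open>Induction on the coordinates by the law of total variance. Conditionally on coordinate
  \<open>j\<close> being \<open>t\<close>, let \<open>m t\<close> be the mean and \<open>s t\<close>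
  the second moment. The variance is then the expectation of \<open>s - m\<^sup>2\<close> plus the
  variance of \<open>m\<close>; the induction hypothesis bounds the first and the Hardy inequality
  the second.\<close>

theorem weighted_poincare:
  fixes f :: "(nat \<Rightarrow> real) \<Rightarrow> real" and G :: "nat \<Rightarrow> (nat \<Rightarrow> real) \<Rightarrow> real"
  assumes a: "0 \<le> a" "a < 1/2" and d: "0 \<le> d" and I: "finite I"
    and "f \<in> borel_measurable (normal_vector I)"
    and "\<And>x. \<bar>f x\<bar> \<le> c + d * (\<Sum>i\<in>I. \<bar>x i\<bar>)"
    and "\<And>i. i \<in> I \<Longrightarrow> G i \<in> borel_measurable (normal_vector I)"
    and "\<And>x i t. i \<in> I \<Longrightarrow> ((\<lambda>t. f (x(i := t))) has_real_derivative G i (x(i := t))) (at t)"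
    and "\<And>x i. i \<in> I \<Longrightarrow> continuous_on UNIV (\<lambda>t. G i (x(i := t)))"
    and "\<And>x i. i \<in> I \<Longrightarrow> \<bar>G i x\<bar> \<le> M"
  shows "(\<integral>x. (f x)\<^sup>2 \<partial>normal_vector I) - (\<integral>x. f x \<partial>normal_vector I)\<^sup>2
     \<le> (\<Sum>i\<in>I. \<integral>x. (G i x)\<^sup>2 / ((1 - 2 * a) * (1 + 2 * a * (x i)\<^sup>2)) \<partial>normal_vector I)"
  using I assms(5-)
proof (induction I arbitrary: f G c rule: finite_induct)
  case empty
  show ?case by (simp add: PiM_empty lebesgue_integral_count_space_finite)
next
  case (insert j I)
  note f [measurable] = insert.prems(1) and growth = insert.prems(2)
    and G [measurable] = insert.prems(3) and der = insert.prems(4)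
    and cont = insert.prems(5) and bd = insert.prems(6)
  let ?\<gamma> = std_normal_distribution and ?N = "normal_vector I" and ?P = "normal_vector (insert j I)"
  let ?W = "\<lambda>i x. (G i x)\<^sup>2 / ((1 - 2 * a) * (1 + 2 * a * (x i)\<^sup>2))"
  interpret N: prob_space ?N by (rule prob_space_normal_vector)
  interpret P: prob_space ?P by (rule prob_space_normal_vector)
  define m where "m t = (\<integral>y. f (y(j := t)) \<partial>?N)" for t
  define s where "s t = (\<integral>y. (f (y(j := t)))\<^sup>2 \<partial>?N)" for t
  define k where "k x = (f x - f (x(j := 0)))\<^sup>2" for x
  have fin: "finite (insert j I)" using insert.hyps by simp
  note fP = integrable_power2_growth[OF fin f growth]
  have slice: "(\<lambda>y. f (y(j := t))) \<in> borel_measurable ?N" for t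
    by (rule measurable_fun_upd_normal_vector[OF f])
  have slice_growth: "\<bar>f (y(j := t))\<bar> \<le> (c + d * \<bar>t\<bar>) + d * (\<Sum>i\<in>I. \<bar>y i\<bar>)" for y t
  proof -
    have "(\<Sum>i\<in>I. \<bar>(y(j := t)) i\<bar>) = (\<Sum>i\<in>I. \<bar>y i\<bar>)"
      using insert.hyps by (intro sum.cong) auto
    then have "(\<Sum>i\<in>insert j I. \<bar>(y(j := t)) i\<bar>) = \<bar>t\<bar> + (\<Sum>i\<in>I. \<bar>y i\<bar>)"
      using insert.hyps by simp
    then show ?thesis
      using growth[of "y(j := t)"] by (simp only: distrib_left add.assoc)
  qed
  note fN = integrable_power2_growth[OF insert.hyps(1) slice slice_growth]
  have W: "integrable ?P (?W i)" if i: "i \<in> insert j I" for i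
  proof (rule P.integrable_const_bound[where B="M\<^sup>2 / (1 - 2 * a)"])
    show "AE x in ?P. norm (?W i x) \<le> M\<^sup>2 / (1 - 2 * a)"
      using weight_bounds[OF a bd[OF i]] by (intro AE_I2) (simp only: real_norm_def abs_of_nonneg)
  qed (use i in measurable)
  have s: "integrable ?\<gamma> s" "integral\<^sup>L ?\<gamma> s = (\<integral>x. (f x)\<^sup>2 \<partial>?P)"
    and m: "integrable ?\<gamma> m" "integral\<^sup>L ?\<gamma> m = integral\<^sup>L ?P f"
    unfolding s_def m_def
    by (rule normal_vector_insert(1,2)[OF fP(1)] normal_vector_insert(1,2)[OF fP(2)])+
  have ms: "(m t)\<^sup>2 \<le> s t" for t
    unfolding m_def s_def by (rule N.expectation_power2_le[OF fN(2,1)])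
  have m2: "integrable ?\<gamma> (\<lambda>t. (m t)\<^sup>2)"
    using m(1) ms by (intro Bochner_Integration.integrable_bound[OF s(1)])
      (auto intro: order_trans[OF _ abs_ge_self])

  \<comment> \<open>Conditional variance: the induction hypothesis is applied to the slice at each
    \<open>t\<close>. Fixing \<open>t\<close> changes the growth constant to
    \<open>c + d * \<bar>t\<bar>\<close>, which is why \<open>c\<close> is generalized in the
    induction.\<close>
  have "(\<integral>t. s t - (m t)\<^sup>2 \<partial>?\<gamma>) \<le> (\<integral>t. (\<Sum>i\<in>I. \<integral>y. ?W i (y(j := t)) \<partial>?N) \<partial>?\<gamma>)"
  proof (rule integral_mono)
    show "integrable ?\<gamma> (\<lambda>t. \<Sum>i\<in>I. \<integral>y. ?W i (y(j := t)) \<partial>?N)"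
      by (intro Bochner_Integration.integrable_sum normal_vector_insert(1) W) auto
    fix t
    have "s t - (m t)\<^sup>2 \<le> (\<Sum>i\<in>I. \<integral>y. (G i (y(j := t)))\<^sup>2 / ((1 - 2 * a) * (1 + 2 * a * (y i)\<^sup>2)) \<partial>?N)"
      unfolding s_def m_def
    proof (rule insert.IH[OF slice slice_growth])
      fix i assume i: "i \<in> I"
      then have ij: "i \<noteq> j" using insert.hyps by auto
      have twist: "(x(i := u))(j := t) = (x(j := t))(i := u)" for x :: "nat \<Rightarrow> real" and u
        using ij by (rule fun_upd_twist)
      show "(\<lambda>y. G i (y(j := t))) \<in> borel_measurable ?N"
        using i by (intro measurable_fun_upd_normal_vector G) auto
      show "((\<lambda>u. f ((x(i := u))(j := t))) has_real_derivative G i ((x(i := u))(j := t))) (at u)" for x u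
        unfolding twist using i by (intro der) auto
      show "continuous_on UNIV (\<lambda>u. G i ((x(i := u))(j := t)))" for x
        unfolding twist using i by (intro cont) auto
      show "\<bar>G i (x(j := t))\<bar> \<le> M" for x using i by (intro bd) auto
    qed
    also have "\<dots> = (\<Sum>i\<in>I. \<integral>y. ?W i (y(j := t)) \<partial>?N)"
      using insert.hyps by (intro sum.cong Bochner_Integration.integral_cong) auto
    finally show "s t - (m t)\<^sup>2 \<le> (\<Sum>i\<in>I. \<integral>y. ?W i (y(j := t)) \<partial>?N)" .
  qed (use s m2 in auto)
  also have "\<dots> = (\<Sum>i\<in>I. \<integral>t. (\<integral>y. ?W i (y(j := t)) \<partial>?N) \<partial>?\<gamma>)"
    by (intro Bochner_Integration.integral_sum normal_vector_insert(1) W) auto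
  also have "\<dots> = (\<Sum>i\<in>I. integral\<^sup>L ?P (?W i))"
    by (intro sum.cong refl normal_vector_insert(2) W) auto
  finally have 1: "(\<integral>t. s t - (m t)\<^sup>2 \<partial>?\<gamma>) \<le> (\<Sum>i\<in>I. integral\<^sup>L ?P (?W i))" .

  have kP: "integrable ?P k"
    unfolding k_def
  proof (rule integrable_power2_growth[OF fin])
    have "(\<lambda>x. f (x(j := 0))) \<in> borel_measurable ?P"
      by (rule measurable_fun_upd_normal_vector) simp
    then show "(\<lambda>x. f x - f (x(j := 0))) \<in> borel_measurable ?P" by simp
    fix x
    have "\<bar>f (x(j := 0))\<bar> \<le> c + d * (\<Sum>i\<in>I. \<bar>x i\<bar>)"
      using slice_growth[of x 0] by simp
    also have "\<dots> \<le> c + d * (\<Sum>i\<in>insert j I. \<bar>x i\<bar>)"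
      using d insert.hyps by (intro add_left_mono mult_left_mono sum_mono2) auto
    finally show "\<bar>f x - f (x(j := 0))\<bar> \<le> 2 * c + 2 * d * (\<Sum>i\<in>insert j I. \<bar>x i\<bar>)"
      using growth[of x] by linarith
  qed
  \<comment> \<open>Variance of the conditional mean: the mean of \<open>m\<close> is replaced by
    \<open>m 0\<close>, and Jensen moves the square of the increment inside the integral over
    \<open>y\<close>. The Hardy inequality then acts on each line in direction \<open>j\<close>, so
    \<open>m\<close> itself is never differentiated.\<close>
  have "(\<integral>t. (m t)\<^sup>2 \<partial>?\<gamma>) - (integral\<^sup>L ?\<gamma> m)\<^sup>2 \<le> (\<integral>t. (m t - m 0)\<^sup>2 \<partial>?\<gamma>)"
    by (rule std_normal.variance_le_second_moment_about[OF m(1) m2])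
  also have "\<dots> \<le> (\<integral>t. (\<integral>y. k (y(j := t)) \<partial>?N) \<partial>?\<gamma>)"
  proof (rule integral_mono)
    show "integrable ?\<gamma> (\<lambda>t. \<integral>y. k (y(j := t)) \<partial>?N)"
      by (rule normal_vector_insert(1)[OF kP])
    show "integrable ?\<gamma> (\<lambda>t. (m t - m 0)\<^sup>2)"
      using m(1) m2 by (simp add: power2_diff)
    fix t
    have i: "integrable ?N (\<lambda>y. f (y(j := t)) - f (y(j := 0)))"
      by (intro Bochner_Integration.integrable_diff fN)
    have "integrable ?N (\<lambda>y. (f (y(j := t)) - f (y(j := 0)))\<^sup>2)"
    proof (rule Bochner_Integration.integrable_bound)
      show "integrable ?N (\<lambda>y. 2 * (f (y(j := t)))\<^sup>2 + 2 * (f (y(j := 0)))\<^sup>2)"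
        by (intro Bochner_Integration.integrable_add integrable_mult_right fN)
      show "(\<lambda>y. (f (y(j := t)) - f (y(j := 0)))\<^sup>2) \<in> borel_measurable ?N"
        using slice by measurable
      have "(u - v)\<^sup>2 \<le> 2 * u\<^sup>2 + 2 * v\<^sup>2" for u v :: real
        using zero_le_power2[of "u + v"] unfolding power2_sum power2_diff by linarith
      then show "AE y in ?N. norm ((f (y(j := t)) - f (y(j := 0)))\<^sup>2)
          \<le> norm (2 * (f (y(j := t)))\<^sup>2 + 2 * (f (y(j := 0)))\<^sup>2)"
        by (intro AE_I2) simp
    qed
    from N.expectation_power2_le[OF i this]
    show "(m t - m 0)\<^sup>2 \<le> (\<integral>y. k (y(j := t)) \<partial>?N)"
      by (simp add: m_def k_def Bochner_Integration.integral_diff[OF fN(2) fN(2)])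
  qed
  also have "\<dots> = (\<integral>y. (\<integral>t. k (y(j := t)) \<partial>?\<gamma>) \<partial>?N)"
    by (simp add: normal_vector_insert(2,4)[OF kP])
  also have "\<dots> \<le> (\<integral>y. (\<integral>t. ?W j (y(j := t)) \<partial>?\<gamma>) \<partial>?N)"
  proof (rule integral_mono[OF normal_vector_insert(3)[OF kP] normal_vector_insert(3)[OF W]])
    fix y
    show "(\<integral>t. k (y(j := t)) \<partial>?\<gamma>) \<le> (\<integral>t. ?W j (y(j := t)) \<partial>?\<gamma>)"
      using gaussian_hardy[OF a, of "\<lambda>t. f (y(j := t))" "\<lambda>t. G j (y(j := t))" M] der cont bd
      by (simp add: k_def)
  qed simp
  also have "\<dots> = integral\<^sup>L ?P (?W j)"
    by (rule normal_vector_insert(4)[OF W]) simp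
  finally have 2: "(\<integral>t. (m t)\<^sup>2 \<partial>?\<gamma>) - (integral\<^sup>L ?\<gamma> m)\<^sup>2 \<le> integral\<^sup>L ?P (?W j)" .
  have "(\<integral>t. s t - (m t)\<^sup>2 \<partial>?\<gamma>) = integral\<^sup>L ?\<gamma> s - (\<integral>t. (m t)\<^sup>2 \<partial>?\<gamma>)"
    by (rule Bochner_Integration.integral_diff[OF s(1) m2])
  then show ?case
    using 1 2 insert.hyps by (simp add: s m)
qed

section \<open>Exchangeability and the number of coordinates above a level\<close>

lemma integral_normal_vector_reindex:
  fixes f :: "(nat \<Rightarrow> real) \<Rightarrow> real"
  assumes \<pi>: "\<pi> permutes I" and f: "f \<in> borel_measurable (normal_vector I)"
  shows "(\<integral>x. f (\<lambda>i\<in>I. x (\<pi> i)) \<partial>normal_vector I) = (\<integral>x. f x \<partial>normal_vector I)"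
proof -
  have m: "(\<lambda>x. \<lambda>i\<in>I. x (\<pi> i)) \<in> measurable (normal_vector I) (normal_vector I)"
    using permutes_in_image[OF \<pi>] by (intro measurable_restrict measurable_component_singleton) auto
  have "distr (normal_vector I) (normal_vector I) (\<lambda>x. \<lambda>i\<in>I. x (\<pi> i)) = normal_vector I"
    using \<pi> by (intro distr_PiM_reindex std_normal.prob_space_axioms)
      (auto intro: permutes_inj_on simp: permutes_in_image)
  from arg_cong[OF this, of "\<lambda>M. integral\<^sup>L M f"] show ?thesis
    by (simp add: integral_distr[OF m f])
qed

text \<open>On the unit interval from \<open>t\<close> to \<open>t + 1\<close> the density is at
  least its value at the right end.\<close>

lemma std_normal_tail_ge:
  assumes t: "0 \<le> t"
  shows "std_normal_density (t + 1) \<le> measure std_normal_distribution {t..}"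
proof -
  have "integrable std_normal_distribution (\<lambda>s. indicator {t..} s :: real)"
    by (rule std_normal.integrable_const_bound[where B=1]) auto
  then have i: "integrable lborel (\<lambda>s. std_normal_density s * indicator {t..} s)"
    by (simp add: integrable_real_density)
  have "std_normal_density (t + 1) = (\<integral>s. std_normal_density (t + 1) * indicator {t..t + 1} s \<partial>lborel)"
    by simp
  also have "\<dots> \<le> (\<integral>s. std_normal_density s * indicator {t..} s \<partial>lborel)"
  proof (rule integral_mono[OF _ i])
    show "integrable lborel (\<lambda>s. std_normal_density (t + 1) * indicator {t..t + 1} s)"
      by (intro integrable_mult_right) (simp add: integrable_indicator_iff)
    fix s :: real
    show "std_normal_density (t + 1) * indicator {t..t + 1} s \<le> std_normal_density s * indicator {t..} s"
    proof (cases "s \<in> {t..t + 1}")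
      case True
      then have "s\<^sup>2 \<le> (t + 1)\<^sup>2" using t by (intro power_mono) auto
      then show ?thesis using True by (simp add: std_normal_density_def divide_right_mono)
    qed simp
  qed
  also have "\<dots> = (\<integral>s. indicator {t..} s \<partial>std_normal_distribution)"
    by (subst integral_density) auto
  also have "\<dots> = measure std_normal_distribution {t..}" by simp
  finally show ?thesis .
qed

lemma norm_inverse_1_plus_le:
  fixes u :: real
  assumes "0 \<le> u"
  shows "norm (1 / (1 + u)) \<le> 1"
  using assms by (simp add: abs_of_nonneg divide_le_eq)

text \<open>By exchangeability each index carries the same share \<open>indicator {t..} (x i) / N x\<close> of a total
  that is at most \<open>1\<close>, where \<open>N\<close> counts the coordinates above \<open>t\<close>; and given that \<open>i\<close> is counted,
  \<open>N\<close> is \<open>1\<close> plus an independent count over the other indices.\<close>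

lemma expectation_inverse_count:
  assumes I: "finite I" "I \<noteq> {}"
  shows "real (card I) * measure std_normal_distribution {t..}
      * (\<integral>x. 1 / (1 + (\<Sum>i\<in>I. indicator {t..} (x i))) \<partial>normal_vector I) \<le> (1 :: real)"
proof -
  let ?p = "measure std_normal_distribution {t..}"
  define N :: "nat set \<Rightarrow> (nat \<Rightarrow> real) \<Rightarrow> real" where "N J x = (\<Sum>i\<in>J. indicator {t..} (x i))" for J x
  define q :: "nat \<Rightarrow> (nat \<Rightarrow> real) \<Rightarrow> real" where "q i x = indicator {t..} (x i) / N I x" for i x
  interpret P: prob_space "normal_vector I" by (rule prob_space_normal_vector)
  have N0: "0 \<le> N J x" for J x by (auto simp: N_def intro: sum_nonneg)
  have N1: "indicator {t..} (x i) \<le> N I x" if "i \<in> I" for i x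
    unfolding N_def using that I by (intro member_le_sum) auto
  have meas [measurable]: "N J \<in> borel_measurable (normal_vector K)" if "J \<subseteq> K" for J K
    unfolding N_def using that
    by (intro borel_measurable_sum measurable_compose[OF measurable_coord]) auto
  have qm [measurable]: "q i \<in> borel_measurable (normal_vector I)" if "i \<in> I" for i
    unfolding q_def using that by measurable auto
  have qi: "integrable (normal_vector I) (q i)" if "i \<in> I" for i
  proof (rule P.integrable_const_bound[where B=1])
    have "0 \<le> q i x \<and> q i x \<le> 1" for x
      using N0[of I x] N1[OF that, of x] by (cases "N I x = 0") (auto simp: q_def)
    then show "AE x in normal_vector I. norm (q i x) \<le> 1" by simp
  qed (use that in measurable)
  obtain j where j: "j \<in> I" using I by auto
  define J where "J = I - {j}"
  have IJ: "I = insert j J" "j \<notin> J" "finite J" using j I by (auto simp: J_def)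
  interpret Q: prob_space "normal_vector J" by (rule prob_space_normal_vector)
  have same: "integral\<^sup>L (normal_vector I) (q i) = integral\<^sup>L (normal_vector I) (q j)" if i: "i \<in> I" for i
  proof -
    let ?\<pi> = "Transposition.transpose i j"
    have \<pi>: "?\<pi> permutes I" using i j by (rule permutes_swap_id)
    have "q j (\<lambda>k\<in>I. x (?\<pi> k)) = q i x" for x
    proof -
      have "N I (\<lambda>k\<in>I. x (?\<pi> k)) = (\<Sum>k\<in>I. indicator {t..} (x (?\<pi> k)))"
        unfolding N_def by (intro sum.cong) auto
      also have "\<dots> = N I x"
        unfolding N_def using permutes_imp_bij[OF \<pi>] by (rule sum.reindex_bij_betw)
      finally show ?thesis using j by (simp add: q_def)
    qed
    then show ?thesis using integral_normal_vector_reindex[OF \<pi> qm[OF j]] by simp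
  qed
  have upd: "N J (y(j := s)) = N J y" for y s
    unfolding N_def using IJ by (intro sum.cong) auto
  have NI: "N I (y(j := s)) = indicator {t..} s + N J y" for y s
    using upd[of y s] IJ by (simp add: N_def)
  \<comment> \<open>Below the level the numerator vanishes; above it the full count is
    \<open>1 + N J y\<close>, which no longer depends on \<open>s\<close>.\<close>
  have inner: "(\<integral>s. q j (y(j := s)) \<partial>std_normal_distribution) = ?p * (1 / (1 + N J y))" for y
  proof -
    have "(\<integral>s. q j (y(j := s)) \<partial>std_normal_distribution)
       = (\<integral>s. indicator {t..} s * (1 / (1 + N J y)) \<partial>std_normal_distribution)"
      by (intro Bochner_Integration.integral_cong) (auto simp: q_def NI indicator_def)
    then show ?thesis by simp
  qed
  have iJ: "integrable (normal_vector J) (\<lambda>y. 1 / (1 + N J y))"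
    by (rule Q.integrable_const_bound[where B=1]) (use norm_inverse_1_plus_le[OF N0] in auto)
  have iI: "integrable (normal_vector I) (\<lambda>y. 1 / (1 + N I y))"
    by (rule P.integrable_const_bound[where B=1]) (use norm_inverse_1_plus_le[OF N0] in auto)
  note iI' = iI[unfolded IJ(1)]
  \<comment> \<open>Restoring coordinate \<open>j\<close> can only increase the count, so the
    expectation over \<open>I\<close> is dominated by the one over \<open>J\<close> that the share
    of \<open>j\<close> produces.\<close>
  have "(\<integral>x. 1 / (1 + N I x) \<partial>normal_vector I)
      = (\<integral>y. (\<integral>s. 1 / (1 + N I (y(j := s))) \<partial>std_normal_distribution) \<partial>normal_vector J)"
    using normal_vector_insert(4)[OF iI'] unfolding IJ(1)[symmetric] by simp
  also have "\<dots> \<le> (\<integral>y. 1 / (1 + N J y) \<partial>normal_vector J)"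
  proof (rule integral_mono[OF _ iJ])
    show "integrable (normal_vector J) (\<lambda>y. \<integral>s. 1 / (1 + N I (y(j := s))) \<partial>std_normal_distribution)"
      using normal_vector_insert(3)[OF iI'] unfolding IJ(1)[symmetric] by simp
    fix y
    have "(\<integral>s. 1 / (1 + N I (y(j := s))) \<partial>std_normal_distribution)
       \<le> (\<integral>s. 1 / (1 + N J y) \<partial>std_normal_distribution)"
    proof (rule integral_mono)
      show "integrable std_normal_distribution (\<lambda>s. 1 / (1 + N I (y(j := s))))"
        unfolding NI using N0[of J y]
        by (intro std_normal.integrable_const_bound[where B=1]) (auto simp: indicator_def)
      show "1 / (1 + N I (y(j := s))) \<le> 1 / (1 + N J y)" for s
        unfolding NI using N0[of J y] by (intro divide_left_mono) (auto simp: indicator_def)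
    qed simp
    then show "(\<integral>s. 1 / (1 + N I (y(j := s))) \<partial>std_normal_distribution) \<le> 1 / (1 + N J y)"
      using std_normal.prob_space by simp
  qed
  finally have "?p * (\<integral>x. 1 / (1 + N I x) \<partial>normal_vector I)
      \<le> ?p * (\<integral>y. 1 / (1 + N J y) \<partial>normal_vector J)"
    by (rule mult_left_mono) simp
  also have "\<dots> = (\<integral>y. ?p * (1 / (1 + N J y)) \<partial>normal_vector J)"
    by (rule integral_mult_right_zero[symmetric])
  also have "\<dots> = integral\<^sup>L (normal_vector I) (q j)"
    using normal_vector_insert(4)[of j J "q j"] qi[OF j] unfolding IJ(1)[symmetric] inner by simp
  finally have "real (card I) * (?p * (\<integral>x. 1 / (1 + N I x) \<partial>normal_vector I))
      \<le> real (card I) * integral\<^sup>L (normal_vector I) (q j)"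
    by (rule mult_left_mono) simp
  also have "\<dots> = (\<Sum>i\<in>I. integral\<^sup>L (normal_vector I) (q i))"
    using same by simp
  also have "\<dots> = (\<integral>x. (\<Sum>i\<in>I. q i x) \<partial>normal_vector I)"
    using qi by (intro Bochner_Integration.integral_sum[symmetric])
  \<comment> \<open>The shares add up to 1 if some coordinate is counted, and otherwise to 0 because
    \<open>0 / 0 = 0\<close>.\<close>
  also have "\<dots> \<le> (\<integral>x. 1 \<partial>normal_vector I)"
  proof (rule integral_mono)
    show "integrable (normal_vector I) (\<lambda>x. \<Sum>i\<in>I. q i x)"
      using qi by (intro Bochner_Integration.integrable_sum)
    show "(\<Sum>i\<in>I. q i x) \<le> 1" for x
      unfolding q_def by (simp add: sum_divide_distrib[symmetric] N_def[symmetric])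
  qed simp
  also have "\<dots> = 1" by (simp add: P.prob_space)
  finally show ?thesis by (simp add: N_def mult.assoc)
qed

section \<open>Gibbs weights as derivatives of the free energy\<close>

definition gibbs :: "nat \<Rightarrow> real \<Rightarrow> nat \<Rightarrow> (nat \<Rightarrow> real) \<Rightarrow> real" where
  "gibbs n \<beta> i x = exp (\<beta> * x i) / (\<Sum>j=1..n. exp (\<beta> * x j))"

lemma std_gaussian_eq: "std_gaussian n = normal_vector {1..n}"
  by (simp add: std_gaussian_def)

context
  fixes n :: nat and \<beta> :: real
  assumes n: "1 \<le> n" and \<beta>: "0 < \<beta>"
begin

lemma partition_function_pos: "0 < (\<Sum>j=1..n. exp (\<beta> * x j))"
  using n by (intro sum_pos) auto

lemma gibbs_pos: "0 < gibbs n \<beta> i x"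
  unfolding gibbs_def by (rule divide_pos_pos[OF exp_gt_zero partition_function_pos])

lemma sum_gibbs: "(\<Sum>i=1..n. gibbs n \<beta> i x) = 1"
  using partition_function_pos[of x] by (simp add: gibbs_def sum_divide_distrib[symmetric])

lemma gibbs_le_1: "i \<in> {1..n} \<Longrightarrow> gibbs n \<beta> i x \<le> 1"
  using member_le_sum[of i "{1..n}" "\<lambda>i. gibbs n \<beta> i x"] gibbs_pos
  unfolding sum_gibbs by (simp add: less_imp_le)

lemma gibbs_measurable [measurable]:
  "i \<in> {1..n} \<Longrightarrow> gibbs n \<beta> i \<in> borel_measurable (normal_vector {1..n})"
  unfolding gibbs_def by measurable

lemma partition_function_has_derivative:
  assumes i: "i \<in> {1..n}"
  shows "((\<lambda>t. \<Sum>j=1..n. exp (\<beta> * (x(i := t)) j)) has_real_derivative \<beta> * exp (\<beta> * t)) (at t)"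
proof -
  have "((\<lambda>t. \<Sum>j=1..n. exp (\<beta> * (x(i := t)) j)) has_real_derivative
     (\<Sum>j=1..n. if j = i then \<beta> * exp (\<beta> * t) else 0)) (at t)"
  proof (rule DERIV_sum)
    fix j
    show "((\<lambda>t. exp (\<beta> * (x(i := t)) j)) has_real_derivative
        (if j = i then \<beta> * exp (\<beta> * t) else 0)) (at t)"
      by (cases "j = i") (auto intro!: derivative_eq_intros)
  qed
  then show ?thesis using i by simp
qed

lemma free_energy_has_derivative:
  assumes i: "i \<in> {1..n}"
  shows "((\<lambda>t. free_energy n \<beta> (x(i := t))) has_real_derivative gibbs n \<beta> i (x(i := t))) (at t)"
  unfolding free_energy_def gibbs_def
  by (rule derivative_eq_intros partition_function_has_derivative[OF i] partition_function_pos refl)+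
     (use \<beta> in simp)

lemma gibbs_has_derivative:
  assumes i: "i \<in> {1..n}"
  shows "((\<lambda>t. gibbs n \<beta> k (x(i := t))) has_real_derivative
     \<beta> * (gibbs n \<beta> k (x(i := t)) * ((if k = i then 1 else 0) - gibbs n \<beta> i (x(i := t))))) (at t)"
proof -
  let ?Z = "\<Sum>j=1..n. exp (\<beta> * (x(i := t)) j)" and ?d = "if k = i then 1 else 0 :: real"
  have Z: "?Z \<noteq> 0" using partition_function_pos[of "x(i := t)"] by simp
  have num: "((\<lambda>t. exp (\<beta> * (x(i := t)) k)) has_real_derivative ?d * (\<beta> * exp (\<beta> * (x(i := t)) k))) (at t)"
    by (cases "k = i") (auto intro!: derivative_eq_intros)
  \<comment> \<open>The quotient rule is simplified with the partition function abstracted to a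
    variable, so that its sum is not expanded.\<close>
  have quotient: "(d * (\<beta> * E) * Z - E * (\<beta> * e)) / (Z * Z) = \<beta> * (E / Z * (d - e / Z))"
    if "Z \<noteq> 0" for d e E Z :: real
    using that by (simp add: field_simps)
  from DERIV_divide[OF num partition_function_has_derivative[OF i] Z]
  show ?thesis
    unfolding gibbs_def
    by (rule DERIV_cong) (simp only: fun_upd_same quotient[OF Z])
qed

lemma gibbs_continuous:
  "i \<in> {1..n} \<Longrightarrow> continuous_on UNIV (\<lambda>t. gibbs n \<beta> k (x(i := t)))"
  by (rule DERIV_continuous_on) (rule DERIV_subset[OF gibbs_has_derivative], auto)

lemma variance_free_energy_le:
  assumes a: "0 \<le> a" "a < 1/2"
  shows "Var_gaussian n (free_energy n \<beta>)
    \<le> (\<Sum>i=1..n. \<integral>x. (gibbs n \<beta> i x)\<^sup>2 / ((1 - 2 * a) * (1 + 2 * a * (x i)\<^sup>2)) \<partial>normal_vector {1..n})"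
  unfolding Var_gaussian_def std_gaussian_eq
proof (rule weighted_poincare[OF a zero_le_one])
  show "free_energy n \<beta> \<in> borel_measurable (normal_vector {1..n})"
    using free_energy_measurable by (simp add: std_gaussian_eq)
  show "\<bar>free_energy n \<beta> x\<bar> \<le> ln (real n) / \<beta> + 1 * (\<Sum>i\<in>{1..n}. \<bar>x i\<bar>)" for x
    using abs_free_energy_le[OF n \<beta>] by simp
  show "\<bar>gibbs n \<beta> i x\<bar> \<le> 1" if "i \<in> {1..n}" for i x
    using gibbs_le_1[OF that] gibbs_pos[of i x] by simp
qed (simp_all only: gibbs_measurable free_energy_has_derivative gibbs_continuous finite_atLeastAtMost)

lemma expectation_gibbs:
  assumes i: "i \<in> {1..n}"
  shows "(\<integral>x. gibbs n \<beta> i x \<partial>normal_vector {1..n}) = 1 / real n"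
proof -
  let ?P = "normal_vector {1..n}"
  interpret prob_space ?P by (rule prob_space_normal_vector)
  have int: "integrable ?P (gibbs n \<beta> k)" if "k \<in> {1..n}" for k
  proof (rule integrable_const_bound[where B=1])
    show "AE x in ?P. norm (gibbs n \<beta> k x) \<le> 1"
      using gibbs_le_1[OF that] gibbs_pos by (intro AE_I2) (simp add: less_imp_le)
  qed (use that in measurable)
  have same: "expectation (gibbs n \<beta> k) = expectation (gibbs n \<beta> i)" if k: "k \<in> {1..n}" for k
  proof -
    let ?\<pi> = "Transposition.transpose k i"
    have \<pi>: "?\<pi> permutes {1..n}" using k i by (rule permutes_swap_id)
    have "gibbs n \<beta> i (\<lambda>j\<in>{1..n}. x (?\<pi> j)) = gibbs n \<beta> k x" for x
    proof -
      have "(\<Sum>j=1..n. exp (\<beta> * (\<lambda>j\<in>{1..n}. x (?\<pi> j)) j)) = (\<Sum>j=1..n. exp (\<beta> * x (?\<pi> j)))"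
        by (intro sum.cong) auto
      also have "\<dots> = (\<Sum>j=1..n. exp (\<beta> * x j))"
        using permutes_imp_bij[OF \<pi>] by (rule sum.reindex_bij_betw)
      finally show ?thesis using i unfolding gibbs_def by simp
    qed
    then show ?thesis using integral_normal_vector_reindex[OF \<pi> gibbs_measurable[OF i]] by simp
  qed
  have "real n * expectation (gibbs n \<beta> i) = (\<Sum>k=1..n. expectation (gibbs n \<beta> k))"
    using same by simp
  also have "\<dots> = expectation (\<lambda>x. \<Sum>k=1..n. gibbs n \<beta> k x)"
    using int by (intro Bochner_Integration.integral_sum[symmetric])
  also have "\<dots> = 1" unfolding sum_gibbs using prob_space by simp
  finally show ?thesis using n by (simp add: field_simps)
qed

end

section \<open>High temperature: a self-bounding estimate for the overlap\<close>

text \<open>With \<open>S\<close> and \<open>T\<close> the sums of squares and cubes, the left-hand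
  side equals \<open>S + S\<^sup>2 - 2 * T\<close>. Under the probability weights
  \<open>\<nu>\<close>, the function \<open>\<nu>\<close> has mean \<open>S\<close> and variance
  \<open>T - S\<^sup>2\<close>, so \<open>S\<^sup>2 \<le> T\<close> and the excess over
  \<open>S\<close> is at most \<open>- T\<close>.\<close>

lemma sum_squares_gibbs_hessian_le:
  fixes \<nu> :: "'a \<Rightarrow> real"
  assumes A: "finite A" and nonneg: "\<And>i. i \<in> A \<Longrightarrow> 0 \<le> \<nu> i" and one: "sum \<nu> A = 1"
  shows "(\<Sum>k\<in>A. \<Sum>i\<in>A. (\<nu> k * ((if k = i then 1 else 0) - \<nu> i))\<^sup>2) \<le> (\<Sum>k\<in>A. (\<nu> k)\<^sup>2)"
proof -
  define S where "S = (\<Sum>k\<in>A. (\<nu> k)\<^sup>2)"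
  define T where "T = (\<Sum>k\<in>A. (\<nu> k) ^ 3)"
  have inner: "(\<Sum>i\<in>A. (\<nu> k * ((if k = i then 1 else 0) - \<nu> i))\<^sup>2) = (1 + S) * (\<nu> k)\<^sup>2 - 2 * (\<nu> k) ^ 3"
    if k: "k \<in> A" for k
  proof -
    have "(\<nu> k * ((if k = i then 1 else 0) - \<nu> i))\<^sup>2
        = (if k = i then (\<nu> k)\<^sup>2 - 2 * (\<nu> k) ^ 3 else 0) + (\<nu> k)\<^sup>2 * (\<nu> i)\<^sup>2" for i
      by (simp add: algebra_simps power2_eq_square power3_eq_cube)
    then have "(\<Sum>i\<in>A. (\<nu> k * ((if k = i then 1 else 0) - \<nu> i))\<^sup>2)
        = (\<Sum>i\<in>A. if k = i then (\<nu> k)\<^sup>2 - 2 * (\<nu> k) ^ 3 else 0) + (\<nu> k)\<^sup>2 * S"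
      by (simp only: sum.distrib sum_distrib_left S_def)
    then show ?thesis using k A by (simp add: algebra_simps)
  qed
  have "0 \<le> (\<Sum>k\<in>A. \<nu> k * (\<nu> k - S)\<^sup>2)"
    using nonneg by (intro sum_nonneg) auto
  also have "\<dots> = (\<Sum>k\<in>A. (\<nu> k) ^ 3 - 2 * S * (\<nu> k)\<^sup>2 + S\<^sup>2 * \<nu> k)"
    by (intro sum.cong refl) (simp add: algebra_simps power2_eq_square power3_eq_cube)
  also have "\<dots> = T - 2 * S * S + S\<^sup>2 * 1"
    by (simp only: sum.distrib sum_subtractf sum_distrib_left[symmetric] S_def T_def one)
  finally have "S\<^sup>2 \<le> T" by (simp add: power2_eq_square)
  moreover have "0 \<le> T" unfolding T_def using nonneg by (intro sum_nonneg) auto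
  ultimately have "(1 + S) * S - 2 * T \<le> S" by (simp add: algebra_simps power2_eq_square)
  then show ?thesis
    using inner by (simp add: sum_subtractf sum_distrib_left[symmetric] S_def T_def)
qed

text \<open>Summing the Poincare inequality over all weights, the squared means contribute
  \<open>n * (1/n)\<^sup>2 = 1/n\<close>, and the gradients contribute at most
  \<open>\<beta>\<^sup>2\<close> times the quantity being bounded, which is moved to the
  left.\<close>

lemma expectation_gibbs_overlap_le:
  assumes n: "1 \<le> n" and \<beta>: "0 < \<beta>"
  shows "(1 - \<beta>\<^sup>2) * (\<Sum>k=1..n. \<integral>x. (gibbs n \<beta> k x)\<^sup>2 \<partial>normal_vector {1..n}) \<le> 1 / real n"
proof -
  let ?P = "normal_vector {1..n}" and ?\<nu> = "gibbs n \<beta>"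
  let ?H = "\<lambda>k i x. ?\<nu> k x * ((if k = i then 1 else 0) - ?\<nu> i x)"
  interpret prob_space ?P by (rule prob_space_normal_vector)
  note [measurable] = gibbs_measurable[OF n \<beta>]
  have b: "\<bar>?\<nu> k x\<bar> \<le> 1" if "k \<in> {1..n}" for k x
    using gibbs_le_1[OF n \<beta> that] gibbs_pos[OF n \<beta>, of k x] by simp
  have bH: "\<bar>?H k i x\<bar> \<le> 1" if "k \<in> {1..n}" "i \<in> {1..n}" for k i x
    using mult_mono[OF b[OF that(1), of x], of "\<bar>(if k = i then 1 else 0) - ?\<nu> i x\<bar>" 1]
      gibbs_le_1[OF n \<beta> that(2), of x] gibbs_pos[OF n \<beta>, of i x]
    by (simp add: abs_mult)
  have iG: "integrable ?P (\<lambda>x. (?\<nu> k x)\<^sup>2)" if k: "k \<in> {1..n}" for k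
  proof (rule integrable_const_bound[where B=1])
    show "AE x in ?P. norm ((?\<nu> k x)\<^sup>2) \<le> 1"
      using b[OF k] by (intro AE_I2) (simp add: abs_square_le_1)
  qed (use k in measurable)
  have iH: "integrable ?P (\<lambda>x. (?H k i x)\<^sup>2)" if k: "k \<in> {1..n}" and i: "i \<in> {1..n}" for k i
  proof (rule integrable_const_bound[where B=1])
    show "AE x in ?P. norm ((?H k i x)\<^sup>2) \<le> 1"
      using bH[OF k i] by (intro AE_I2) (simp only: real_norm_def abs_power2 abs_square_le_1)
  qed (use k i in measurable)
  have "expectation (\<lambda>x. (?\<nu> k x)\<^sup>2) \<le> (1 / real n)\<^sup>2 + \<beta>\<^sup>2 * (\<Sum>i=1..n. expectation (\<lambda>x. (?H k i x)\<^sup>2))"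
    if k: "k \<in> {1..n}" for k
  proof -
    have "expectation (\<lambda>x. (?\<nu> k x)\<^sup>2) - (expectation (?\<nu> k))\<^sup>2
       \<le> (\<Sum>i\<in>{1..n}. \<integral>x. (\<beta> * ?H k i x)\<^sup>2 / ((1 - 2 * 0) * (1 + 2 * 0 * (x i)\<^sup>2)) \<partial>?P)"
    \<comment> \<open>The weights lie between 0 and 1, so the growth bound is constant;
      \<open>M = \<beta>\<close> works because the entries \<open>?H k i\<close> are at most 1 in
      absolute value.\<close>
    proof (rule weighted_poincare[where c=1 and d=0 and M=\<beta>])
      show "?\<nu> k \<in> borel_measurable ?P" by (rule gibbs_measurable[OF n \<beta> k])
      show "\<bar>?\<nu> k x\<bar> \<le> 1 + 0 * (\<Sum>i\<in>{1..n}. \<bar>x i\<bar>)" for x using b[OF k] by simp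
      fix i assume i: "i \<in> {1..n}"
      show "(\<lambda>x. \<beta> * ?H k i x) \<in> borel_measurable ?P" using i k by measurable
      show "((\<lambda>t. ?\<nu> k (x(i := t))) has_real_derivative \<beta> * ?H k i (x(i := t))) (at t)" for x t
        by (rule gibbs_has_derivative[OF n \<beta> i])
      show "continuous_on UNIV (\<lambda>t. \<beta> * ?H k i (x(i := t)))" for x
        by (intro continuous_intros gibbs_continuous[OF n \<beta> i])
      show "\<bar>\<beta> * ?H k i x\<bar> \<le> \<beta>" for x
        using mult_left_mono[OF bH[OF k i, of x], of \<beta>] \<beta> by (simp add: abs_mult[of \<beta>])
    qed auto
    also have "\<dots> = \<beta>\<^sup>2 * (\<Sum>i=1..n. expectation (\<lambda>x. (?H k i x)\<^sup>2))"
      unfolding sum_distrib_left by (intro sum.cong refl) (simp add: power_mult_distrib[of \<beta>])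
    finally show ?thesis unfolding expectation_gibbs[OF n \<beta> k] by linarith
  qed
  then have "(\<Sum>k=1..n. expectation (\<lambda>x. (?\<nu> k x)\<^sup>2))
      \<le> (\<Sum>k=1..n. (1 / real n)\<^sup>2 + \<beta>\<^sup>2 * (\<Sum>i=1..n. expectation (\<lambda>x. (?H k i x)\<^sup>2)))"
    by (rule sum_mono)
  also have "\<dots> = 1 / real n + \<beta>\<^sup>2 * (\<Sum>k=1..n. \<Sum>i=1..n. expectation (\<lambda>x. (?H k i x)\<^sup>2))"
    using n by (simp add: sum.distrib sum_distrib_left power2_eq_square)
  finally have main: "(\<Sum>k=1..n. expectation (\<lambda>x. (?\<nu> k x)\<^sup>2))
      \<le> 1 / real n + \<beta>\<^sup>2 * (\<Sum>k=1..n. \<Sum>i=1..n. expectation (\<lambda>x. (?H k i x)\<^sup>2))" .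
  have "(\<Sum>k=1..n. \<Sum>i=1..n. expectation (\<lambda>x. (?H k i x)\<^sup>2))
      = expectation (\<lambda>x. \<Sum>k=1..n. \<Sum>i=1..n. (?H k i x)\<^sup>2)"
    using iH by (subst Bochner_Integration.integral_sum)
      (auto intro!: Bochner_Integration.integrable_sum sum.cong Bochner_Integration.integral_sum[symmetric]
        simp del: One_nat_def)
  also have "\<dots> \<le> expectation (\<lambda>x. \<Sum>k=1..n. (?\<nu> k x)\<^sup>2)"
  proof (rule integral_mono)
    show "(\<Sum>k=1..n. \<Sum>i=1..n. (?H k i x)\<^sup>2) \<le> (\<Sum>k=1..n. (?\<nu> k x)\<^sup>2)" for x
      using sum_gibbs[OF n \<beta>, of x] gibbs_pos[OF n \<beta>]
      by (intro sum_squares_gibbs_hessian_le) (auto simp: less_imp_le)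
  qed (intro Bochner_Integration.integrable_sum iG iH; assumption)+
  also have "\<dots> = (\<Sum>k=1..n. expectation (\<lambda>x. (?\<nu> k x)\<^sup>2))"
    by (intro Bochner_Integration.integral_sum iG)
  finally have "\<beta>\<^sup>2 * (\<Sum>k=1..n. \<Sum>i=1..n. expectation (\<lambda>x. (?H k i x)\<^sup>2))
      \<le> \<beta>\<^sup>2 * (\<Sum>k=1..n. expectation (\<lambda>x. (?\<nu> k x)\<^sup>2))"
    by (rule mult_left_mono) simp
  with main show ?thesis unfolding left_diff_distrib mult_1 by linarith
qed

lemma variance_free_energy_high_temperature:
  assumes n: "1 \<le> n" and \<beta>: "0 < \<beta>" "\<beta>\<^sup>2 < 1"
  shows "Var_gaussian n (free_energy n \<beta>) \<le> 1 / (1 - \<beta>\<^sup>2) * (1 / real n)"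
proof -
  let ?S = "\<Sum>k=1..n. \<integral>x. (gibbs n \<beta> k x)\<^sup>2 \<partial>normal_vector {1..n}"
  have "Var_gaussian n (free_energy n \<beta>) \<le> ?S"
    using variance_free_energy_le[OF n \<beta>(1), of 0] by simp
  also have "?S \<le> (1 / real n) / (1 - \<beta>\<^sup>2)"
    using expectation_gibbs_overlap_le[OF n \<beta>(1)] \<beta>(2)
    by (subst pos_le_divide_eq) (simp_all only: mult.commute diff_gt_0_iff_gt)
  also have "\<dots> = 1 / (1 - \<beta>\<^sup>2) * (1 / real n)" by simp
  finally show ?thesis .
qed

section \<open>Low temperature: large coordinates and the count above a threshold\<close>

text \<open>For \<open>a = 1/4\<close> the weighted term is
  \<open>4 * \<nu>\<^sub>i\<^sup>2 / (2 + x\<^sub>i\<^sup>2)\<close>. One factor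
  \<open>\<nu>\<^sub>i\<close> is kept as a probability weight, so the rest only needs a bound that
  is the same for all \<open>i\<close>.\<close>

lemma variance_free_energy_threshold:
  assumes n: "1 \<le> n" and \<beta>: "0 < \<beta>" and t: "0 < t"
  shows "Var_gaussian n (free_energy n \<beta>)
    \<le> 4 / t\<^sup>2 + 2 * (\<integral>x. 1 / (1 + (\<Sum>i\<in>{1..n}. indicator {t..} (x i))) \<partial>normal_vector {1..n})"
proof -
  let ?P = "normal_vector {1..n}" and ?\<nu> = "gibbs n \<beta>"
  let ?N = "\<lambda>x :: nat \<Rightarrow> real. (\<Sum>i\<in>{1..n}. indicator {t..} (x i)) :: real"
  let ?W = "\<lambda>i x. (?\<nu> i x)\<^sup>2 / ((1 - 2 * (1/4)) * (1 + 2 * (1/4) * (x i)\<^sup>2))"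
  interpret prob_space ?P by (rule prob_space_normal_vector)
  note [measurable] = gibbs_measurable[OF n \<beta>]
  have N0: "0 \<le> ?N x" for x by (intro sum_nonneg) auto
  have W: "integrable ?P (?W i)" if i: "i \<in> {1..n}" for i
  proof (rule integrable_const_bound[where B="1\<^sup>2 / (1 - 2 * (1/4))"])
    have "\<bar>?\<nu> i x\<bar> \<le> 1" for x
      using gibbs_le_1[OF n \<beta> i, of x] gibbs_pos[OF n \<beta>, of i x] by simp
    from weight_bounds[OF _ _ this, of "1/4"]
    show "AE x in ?P. norm (?W i x) \<le> 1\<^sup>2 / (1 - 2 * (1/4))"
      by (intro AE_I2) (simp only: real_norm_def abs_of_nonneg)
  qed (use i in measurable)
  have iN: "integrable ?P (\<lambda>x. 1 / (1 + ?N x))"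
  proof (rule integrable_const_bound[where B=1])
    show "AE x in ?P. norm (1 / (1 + ?N x)) \<le> 1"
      using norm_inverse_1_plus_le[OF N0] by (intro AE_I2)
  qed measurable
  have pointwise: "?W i x \<le> ?\<nu> i x * (4 / t\<^sup>2 + 2 * (1 / (1 + ?N x)))" if i: "i \<in> {1..n}" for i x
  proof -
    have \<nu>: "0 < ?\<nu> i x" "?\<nu> i x \<le> 1"
      using gibbs_pos[OF n \<beta>] gibbs_le_1[OF n \<beta> i] by auto
    have W_eq: "?W i x = ?\<nu> i x * (?\<nu> i x * (4 / (2 + (x i)\<^sup>2)))"
    proof -
      have "2 + (x i)\<^sup>2 > 0" by (intro add_pos_nonneg) auto
      then show ?thesis by (simp add: field_simps power2_eq_square)
    qed
    have "?\<nu> i x * (4 / (2 + (x i)\<^sup>2)) \<le> 4 / t\<^sup>2 + 2 * (1 / (1 + ?N x))"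
    proof (cases "t \<le> x i")
      case True
      have "t\<^sup>2 \<le> (x i)\<^sup>2" using t by (intro power_mono[OF True]) simp
      then have "t\<^sup>2 \<le> 2 + (x i)\<^sup>2" by simp
      then have "4 / (2 + (x i)\<^sup>2) \<le> 4 / t\<^sup>2" using t by (intro divide_left_mono) (auto intro!: mult_pos_pos add_pos_nonneg)
      then have "?\<nu> i x * (4 / (2 + (x i)\<^sup>2)) \<le> 1 * (4 / t\<^sup>2)"
        using \<nu> by (intro mult_mono) auto
      then show ?thesis using N0[of x] by (simp add: add_increasing2)
    next
      case False
      let ?e = "exp (\<beta> * x i)"
      \<comment> \<open>Index \<open>i\<close> is below the level and not counted, while every
        counted \<open>j\<close> has an exponential at least \<open>?e\<close>. So the partition
        function is at least \<open>(1 + ?N x) * ?e\<close>.\<close>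
      have "(1 + ?N x) * ?e = ?e + (\<Sum>j\<in>{1..n} - {i}. indicator {t..} (x j) * ?e)"
        using False i by (simp add: sum.remove[of _ i] distrib_right sum_distrib_right)
      also have "\<dots> \<le> ?e + (\<Sum>j\<in>{1..n} - {i}. exp (\<beta> * x j))"
        using False \<beta> by (intro add_left_mono sum_mono) (auto simp: indicator_def)
      also have "\<dots> = (\<Sum>j=1..n. exp (\<beta> * x j))"
        using i by (simp add: sum.remove[of _ i])
      finally have "?\<nu> i x \<le> 1 / (1 + ?N x)"
        unfolding gibbs_def using partition_function_pos[OF n \<beta>, of x] N0[of x]
        by (simp add: field_simps)
      moreover have "4 / (2 + (x i)\<^sup>2) \<le> 2" by (simp add: divide_le_eq add_pos_nonneg)
      ultimately have "?\<nu> i x * (4 / (2 + (x i)\<^sup>2)) \<le> 1 / (1 + ?N x) * 2"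
        using N0[of x] by (intro mult_mono) auto
      then show ?thesis using t by (simp add: add_increasing)
    qed
    then show ?thesis unfolding W_eq using \<nu> by (intro mult_left_mono) auto
  qed
  have "Var_gaussian n (free_energy n \<beta>) \<le> (\<Sum>i=1..n. expectation (?W i))"
    by (rule variance_free_energy_le[OF n \<beta>]) auto
  also have "\<dots> = expectation (\<lambda>x. \<Sum>i=1..n. ?W i x)"
    by (intro Bochner_Integration.integral_sum[symmetric] W)
  also have "\<dots> \<le> expectation (\<lambda>x. 4 / t\<^sup>2 + 2 * (1 / (1 + ?N x)))"
  proof (rule integral_mono)
    fix x
    have "(\<Sum>i=1..n. ?W i x) \<le> (\<Sum>i=1..n. ?\<nu> i x * (4 / t\<^sup>2 + 2 * (1 / (1 + ?N x))))"
      by (intro sum_mono pointwise)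
    then show "(\<Sum>i=1..n. ?W i x) \<le> 4 / t\<^sup>2 + 2 * (1 / (1 + ?N x))"
      by (simp only: sum_distrib_right[symmetric] sum_gibbs[OF n \<beta>] mult_1)
  qed (intro Bochner_Integration.integrable_sum W Bochner_Integration.integrable_add
        integrable_const integrable_mult_right iN; assumption)+
  also have "\<dots> = 4 / t\<^sup>2 + 2 * expectation (\<lambda>x. 1 / (1 + ?N x))"
    by (simp only: Bochner_Integration.integral_add[OF integrable_const integrable_mult_right[OF iN]]
        integral_mult_right_zero lebesgue_integral_const prob_space scaleR_one)
  finally show ?thesis .
qed

text \<open>Put \<open>K = exp 1 * sqrt (2 * pi)\<close>. With \<open>t\<^sup>2 = L / 2\<close> the
  tail is at least \<open>1 / (K * sqrt n)\<close>, so the count estimate gives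
  \<open>E \<le> K / sqrt n\<close>. The two contributions are then \<open>8 / L\<close> and at most
  \<open>4 * K / L\<close>.\<close>

lemma variance_free_energy_le_log:
  assumes n: "exp 1 \<le> real n" and \<beta>: "0 < \<beta>"
  shows "Var_gaussian n (free_energy n \<beta>) \<le> (8 + 4 * (exp 1 * sqrt (2 * pi))) / ln (real n)"
proof -
  define L where "L = ln (real n)"
  define t where "t = sqrt (L / 2)"
  define p where "p = measure std_normal_distribution {t..}"
  define E where "E = (\<integral>x. 1 / (1 + (\<Sum>i\<in>{1..n}. indicator {t..} (x i))) \<partial>normal_vector {1..n} :: real)"
  have n1: "1 \<le> n" and L: "1 \<le> L"
  proof -
    have "0 < real n" using n exp_gt_zero[of "1::real"] by linarith
    then show "1 \<le> n" and "1 \<le> L" using n by (auto simp: L_def ln_ge_iff)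
  qed
  have t: "0 < t" "t\<^sup>2 = L / 2" using L by (auto simp: t_def)
  have "exp (- 1) * (1 / sqrt (real n)) = exp (- 1 - t\<^sup>2)"
  proof -
    have "exp (- t\<^sup>2) = 1 / sqrt (real n)"
      using n1 by (simp add: t(2) L_def exp_minus ln_sqrt[symmetric] inverse_eq_divide)
    then show ?thesis by (simp add: exp_diff exp_minus field_simps)
  qed
  \<comment> \<open>Here \<open>(t + 1)\<^sup>2 / 2 \<le> 1 + t\<^sup>2\<close>, with difference
    \<open>(t - 1)\<^sup>2 / 2\<close>.\<close>
  also have "\<dots> \<le> exp (- (t + 1)\<^sup>2 / 2)"
    using zero_le_power2[of "t - 1"] by (simp add: power2_eq_square algebra_simps)
  finally have "exp (- 1) * (1 / sqrt (real n)) * (1 / sqrt (2 * pi))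
      \<le> exp (- (t + 1)\<^sup>2 / 2) * (1 / sqrt (2 * pi))"
    by (rule mult_right_mono) simp
  also have "\<dots> = std_normal_density (t + 1)"
    unfolding std_normal_density_def by (rule mult.commute)
  also have "\<dots> \<le> p" unfolding p_def using t by (intro std_normal_tail_ge) simp
  finally have p: "1 / (exp 1 * sqrt (2 * pi) * sqrt (real n)) \<le> p"
    by (simp add: exp_minus field_simps)
  have E0: "0 \<le> E" unfolding E_def by (intro Bochner_Integration.integral_nonneg) (auto intro!: add_nonneg_nonneg sum_nonneg)
  have "real n * (1 / (exp 1 * sqrt (2 * pi) * sqrt (real n))) * E \<le> real n * p * E"
    using p E0 by (intro mult_right_mono mult_left_mono) auto
  also have "\<dots> \<le> 1"
    using expectation_inverse_count[of "{1..n}" t] n1 by (simp add: p_def E_def)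
  finally have le_1: "real n * (1 / (exp 1 * sqrt (2 * pi) * sqrt (real n))) * E \<le> 1" .
  have "r * E \<le> K" if "r * r * (1 / (K * r)) * E \<le> 1" "0 < r" "0 < K" for r K :: real
    using that by (simp add: field_simps)
  from this[of "sqrt (real n)" "exp 1 * sqrt (2 * pi)"] le_1
  have "sqrt (real n) * E \<le> exp 1 * sqrt (2 * pi)"
    using n1 by simp
  \<comment> \<open>\<open>L / 2\<close> is the logarithm of \<open>sqrt n\<close>, so the decay
    \<open>1 / sqrt n\<close> of \<open>E\<close> is absorbed into \<open>1 / L\<close>.\<close>
  moreover have "L / 2 \<le> sqrt (real n)"
    using ln_le_minus_one[of "sqrt (real n)"] n1 by (simp add: L_def ln_sqrt)
  then have "L / 2 * E \<le> sqrt (real n) * E" using E0 by (rule mult_right_mono)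
  ultimately have E: "L * E \<le> 2 * (exp 1 * sqrt (2 * pi))" by linarith
  have "Var_gaussian n (free_energy n \<beta>) \<le> 4 / t\<^sup>2 + 2 * E"
    unfolding E_def by (rule variance_free_energy_threshold[OF n1 \<beta> t(1)])
  also have "\<dots> \<le> (8 + 4 * (exp 1 * sqrt (2 * pi))) / L"
    using E L by (simp add: t(2) field_simps)
  finally show ?thesis by (simp add: L_def)
qed

theorem proposition1p2:
  shows "(\<forall>(\<beta>::real) (n::nat). 0 < \<beta> \<and> \<beta> < sqrt (ln 2 / 2) \<and> n \<ge> 1 \<longrightarrow>
            Var_gaussian n (free_energy n \<beta>) \<le> (1 - \<beta>\<^sup>2) / (1 - 2 * \<beta>\<^sup>2) * (1 / real n))
       \<and> (\<exists>C>0. \<forall>\<beta> :: nat \<Rightarrow> real.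
            (\<forall>n\<ge>1. \<beta> n > 0) \<and> (\<lambda>n. \<beta> n / sqrt (ln (real n))) \<longlonglongrightarrow> 1 \<longrightarrow>
            (\<forall>n::nat. real n \<ge> exp 1 \<longrightarrow>
              Var_gaussian n (free_energy n (\<beta> n)) \<le> C / ln (real n)))"
proof (intro conjI allI impI)
  fix \<beta> :: real and n :: nat
  assume *: "0 < \<beta> \<and> \<beta> < sqrt (ln 2 / 2) \<and> n \<ge> 1"
  \<comment> \<open>Because \<open>ln 2 < 1\<close>, the temperature range keeps
    \<open>1 - 2 * \<beta>\<^sup>2\<close> positive, so the fractions can be compared by
    cross-multiplying.\<close>
  have "\<beta>\<^sup>2 < (sqrt (ln 2 / 2))\<^sup>2" using * by (intro power_strict_mono) auto
  also have "\<dots> < 1 / 2" using ln_2_less_1 by simp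
  finally have b: "\<beta>\<^sup>2 < 1 / 2" .
  \<comment> \<open>The two sides differ by \<open>\<beta> ^ 4\<close>.\<close>
  have "(1 - 2 * \<beta>\<^sup>2) \<le> (1 - \<beta>\<^sup>2) * (1 - \<beta>\<^sup>2)"
    using zero_le_power2[of "\<beta>\<^sup>2"] by (simp add: algebra_simps power2_eq_square)
  then have "1 / (1 - \<beta>\<^sup>2) \<le> (1 - \<beta>\<^sup>2) / (1 - 2 * \<beta>\<^sup>2)"
    using b by (simp add: field_simps)
  then have "1 / (1 - \<beta>\<^sup>2) * (1 / real n) \<le> (1 - \<beta>\<^sup>2) / (1 - 2 * \<beta>\<^sup>2) * (1 / real n)"
    by (rule mult_right_mono) simp
  then show "Var_gaussian n (free_energy n \<beta>) \<le> (1 - \<beta>\<^sup>2) / (1 - 2 * \<beta>\<^sup>2) * (1 / real n)"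
    using variance_free_energy_high_temperature[of n \<beta>] * b by linarith
next
  show "\<exists>C>0. \<forall>\<beta> :: nat \<Rightarrow> real.
            (\<forall>n\<ge>1. \<beta> n > 0) \<and> (\<lambda>n. \<beta> n / sqrt (ln (real n))) \<longlonglongrightarrow> 1 \<longrightarrow>
            (\<forall>n::nat. real n \<ge> exp 1 \<longrightarrow>
              Var_gaussian n (free_energy n (\<beta> n)) \<le> C / ln (real n))"
  proof (intro exI[of _ "8 + 4 * (exp 1 * sqrt (2 * pi))"] conjI allI impI)
    show "0 < 8 + 4 * (exp 1 * sqrt (2 * pi))" by (intro add_pos_nonneg) auto
    fix \<beta> :: "nat \<Rightarrow> real" and n :: nat
    assume \<beta>: "(\<forall>n\<ge>1. \<beta> n > 0) \<and> (\<lambda>n. \<beta> n / sqrt (ln (real n))) \<longlonglongrightarrow> 1"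
      and n: "real n \<ge> exp 1"
    have "0 < real n" using n exp_gt_zero[of "1::real"] by linarith
    then have "0 < \<beta> n" using \<beta> by simp
    then show "Var_gaussian n (free_energy n (\<beta> n)) \<le> (8 + 4 * (exp 1 * sqrt (2 * pi))) / ln (real n)"
      by (rule variance_free_energy_le_log[OF n])
  qed
qed

end
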